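(* (i) Let $S$ be a confluent fragment of $\lambda_{lin}^{=}$. For every closed term $M\in S$ and value $V$, if $M\to^{=*}_{\ell\cup\beta}V$ (equality restricted to $S$), then there is a value $V'$ with $(\widetilde M)~\lambda x\,x\to^{*}_{a\cup\beta}\Psi(V')$ and $V(\to^{=}_\ell)^{*}V'$. (ii) Let $S$ be a confluent fragment of $\lambda_{alg}^{=}$. For every closed term $M\in S$ and value $V$, if $M\to^{=*}_{a\cup\beta}V$ (equality restricted to $S$), then there is a value $V'$ with $(\overline M)~\lambda x\,x\to^{*}_{\ell\cup\beta}\Phi(V')$ and $V(\to^{=}_a)^{*}V'$.
   Context: Fix a ring of scalars (elements $\alpha,\beta$). Terms, values and base terms are given by: $M,N,L ::= V \mid (M)~N \mid \alpha.M \mid M+N$ (terms); $U,V,W ::= 0 \mid B \mid \alpha.V \mid V+W$ (values); $B ::= x \mid \lambda x\,M$ (base terms). Terms are taken up to renaming of bound variables; $M[x:=N]$ is capture-avoiding substitution. Below $V$ is a value and $B$ a base term. Rewrite rules: $(\beta_n)$ $(\lambda x\,M)~N\to M[x:=N]$. $(A)$ $(M+N)~L\to (M)~L+(N)~L$; $(\alpha.M)~N\to\alpha.(M)~N$; $(0)~M\to 0$. $(\beta_v)$ $(\lambda x\,M)~B\to M[x:=B]$. $(A_l)$ $(M+N)~V\to(M)~V+(N)~V$; $(\alpha.M)~V\to\alpha.(M)~V$; $(0)~V\to 0$. $(A_r)$ $(B)~(M+N)\to(B)~M+(B)~N$; $(B)~(\alpha.M)\to\alpha.(B)~M$; $(B)~0\to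 0$. (Asso) $M+(N+L)\to(M+N)+L$ and $(M+N)+L\to M+(N+L)$. (Com) $M+N\to N+M$. $(F)$ $\alpha.M+\beta.M\to(\alpha+\beta).M$; $\alpha.M+M\to(\alpha+1).M$; $M+M\to(1+1).M$; $\alpha.(\beta.M)\to(\alpha\beta).M$. $(S)$ $\alpha.(M+N)\to\alpha.M+\alpha.N$; $1.M\to M$; $0.M\to 0$; $\alpha.0\to 0$; $0+M\to M$. Context rules $(\xi)$: from $M\to M'$ infer $(M)~N\to(M')~N$, $M+N\to M'+N$, $N+M\to N+M'$, $\alpha.M\to\alpha.M'$. Context rule $(\xi_{lin})$: from $M\to M'$ infer $(V)~M\to(V)~M'$ for $V$ a value. Let $L=\mathrm{Asso}\cup\mathrm{Com}\cup F\cup S$. Define: $\to_a$ generated by $A\cup L$ closed under $\xi$; $\to_\ell$ generated by $A_l\cup A_r\cup L$ closed under $\xi,\xi_{lin}$; $\to_{\beta_v}$ generated by $\beta_v$ closed under $\xi,\xi_{lin}$; $\to_{\beta_n}$ generated by $\beta_n$ closed under $\xi$. $R^{*}$ is reflexive-transitive closure. $\to_{\ell\cup\beta}:=\to_\ell\cup\to_{\beta_v}$ (language $\lambda_{lin}^{\to}$), $\to_{a\cup\beta}:=\to_a\cup\to_{\beta_n}$ (language $\lambda_{alg}^{\to}$). Fragments: a fragment of $\lambda_{lin}^{\to}$ (resp. $\lambda_{alg}^{\to}$) is a set $S$ of terms closed under $\to_{\ell\cup\beta}$ (resp. $\to_{a\cup\beta}$); it is confluent if that relation restricted to $S$ is confluent.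 A (confluent) fragment of $\lambda_{lin}^{=}$ (resp. $\lambda_{alg}^{=}$) is such an $S$ equipped with the restricted algebraic equality: $M\to^{=}_\ell N$ iff $M,N\in S$ and ($M\to_\ell N$ or $N\to_\ell M$) (resp. with $\to_a$); its reduction $\to^{=}_{\ell\cup\beta}$ (resp. $\to^{=}_{a\cup\beta}$) is this relation union $\to_{\beta_v}$ (resp. $\to_{\beta_n}$). First translation (with $f,g,h$ fresh): $\widetilde{x}=\lambda f\,(f)~x$; $\widetilde{0}=0$; $\widetilde{\lambda x\,M}=\lambda f\,(f)~\lambda x\,\widetilde{M}$; $\widetilde{(M)~N}=\lambda f\,(\widetilde M)~\lambda g\,(\widetilde N)~\lambda h\,((g)~h)~f$; $\widetilde{\alpha.M}=\lambda f\,(\alpha.\widetilde M)~f$; $\widetilde{M+N}=\lambda f\,(\widetilde M+\widetilde N)~f$; on values $\Psi(x)=x$, $\Psi(0)=0$, $\Psi(\lambda x\,M)=\lambda x\,\widetilde M$, $\Psi(\alpha.V)=\alpha.\Psi(V)$, $\Psi(V+W)=\Psi(V)+\Psi(W)$. Second translation (with $f,g,y$ fresh): $\overline{x}=x$; $\overline{0}=\lambda f\,(0)~f$; $\overline{\lambda x\,M}=\lambda f\,(f)~\lambda x\,\overline M$; $\overline{(M)~N}=\lambda f\,(\overline M)~\lambda g\,((g)~\overline N)~f$; $\overline{\alpha.M}=\lambda f\,(\alpha.\overline M)~f$; $\overline{M+N}=\lambda f\,(\overline M+\overline N)~f$; on values $\Phi(x)=(x)~\lambda y\,y$, $\Phi(0)=0$,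 $\Phi(\lambda x\,M)=\lambda x\,\overline M$, $\Phi(\alpha.V)=\alpha.\Phi(V)$, $\Phi(V+W)=\Phi(V)+\Phi(W)$. *)

theory Defs
  imports Main "HOL-Library.Confluence"
begin

section \<open>Terms\<close>

text \<open>
  Terms up to renaming of bound variables are represented with de Bruijn indices;
  \<open>App M N\<close> is the application written \<open>(M) N\<close> on paper.  The intended scalars are the
  elements of a unital ring, not necessarily commutative and possibly trivial.  The class
  \<open>ring_1\<close> excludes the trivial ring, so the statements use the sort
  \<open>{ring, monoid_mult}\<close> instead.
\<close>

datatype 'a trm =
    Var nat
  | Zero
  | Lam "'a trm"
  | App "'a trm" "'a trm"
  | Scale 'a "'a trm"
  | Plus "'a trm" "'a trm"

text \<open>\<open>lift M k\<close> makes room for a fresh binder: it increments the indices \<open>\<ge> k\<close>.\<close>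

primrec lift :: "'a trm \<Rightarrow> nat \<Rightarrow> 'a trm" where
  "lift (Var i) k = (if i < k then Var i else Var (Suc i))"
| "lift Zero k = Zero"
| "lift (Lam M) k = Lam (lift M (Suc k))"
| "lift (App M N) k = App (lift M k) (lift N k)"
| "lift (Scale a M) k = Scale a (lift M k)"
| "lift (Plus M N) k = Plus (lift M k) (lift N k)"

text \<open>\<open>subst M N k\<close> replaces index \<open>k\<close> by \<open>N\<close> and removes the binder it belongs to.\<close>

primrec subst :: "'a trm \<Rightarrow> 'a trm \<Rightarrow> nat \<Rightarrow> 'a trm" where
  "subst (Var i) N k = (if k < i then Var (i - 1) else if i = k then N else Var i)"
| "subst Zero N k = Zero"
| "subst (Lam M) N k = Lam (subst M (lift N 0) (Suc k))"
| "subst (App M L) N k = App (subst M N k) (subst L N k)"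
| "subst (Scale a M) N k = Scale a (subst M N k)"
| "subst (Plus M L) N k = Plus (subst M N k) (subst L N k)"

primrec fv :: "'a trm \<Rightarrow> nat set" where
  "fv (Var i) = {i}"
| "fv Zero = {}"
| "fv (Lam M) = {i. Suc i \<in> fv M}"
| "fv (App M N) = fv M \<union> fv N"
| "fv (Scale a M) = fv M"
| "fv (Plus M N) = fv M \<union> fv N"

definition closed_trm :: "'a trm \<Rightarrow> bool" where
  "closed_trm M \<longleftrightarrow> fv M = {}"

primrec is_base :: "'a trm \<Rightarrow> bool" where
  "is_base (Var i) \<longleftrightarrow> True"
| "is_base Zero \<longleftrightarrow> False"
| "is_base (Lam M) \<longleftrightarrow> True"
| "is_base (App M N) \<longleftrightarrow> False"
| "is_base (Scale a M) \<longleftrightarrow> False"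
| "is_base (Plus M N) \<longleftrightarrow> False"

inductive is_value :: "'a trm \<Rightarrow> bool" where
  "is_value Zero"
| "is_base B \<Longrightarrow> is_value B"
| "is_value V \<Longrightarrow> is_value (Scale a V)"
| "is_value V \<Longrightarrow> is_value W \<Longrightarrow> is_value (Plus V W)"


section \<open>Rewrite rules\<close>

inductive rule_beta_n :: "'a trm \<Rightarrow> 'a trm \<Rightarrow> bool" where
  "rule_beta_n (App (Lam M) N) (subst M N 0)"

inductive rule_beta_v :: "'a trm \<Rightarrow> 'a trm \<Rightarrow> bool" where
  "is_base B \<Longrightarrow> rule_beta_v (App (Lam M) B) (subst M B 0)"

inductive rule_A :: "'a trm \<Rightarrow> 'a trm \<Rightarrow> bool" where
  "rule_A (App (Plus M N) L) (Plus (App M L) (App N L))"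
| "rule_A (App (Scale a M) N) (Scale a (App M N))"
| "rule_A (App Zero M) Zero"

inductive rule_Al :: "'a trm \<Rightarrow> 'a trm \<Rightarrow> bool" where
  "is_value V \<Longrightarrow> rule_Al (App (Plus M N) V) (Plus (App M V) (App N V))"
| "is_value V \<Longrightarrow> rule_Al (App (Scale a M) V) (Scale a (App M V))"
| "is_value V \<Longrightarrow> rule_Al (App Zero V) Zero"

inductive rule_Ar :: "'a trm \<Rightarrow> 'a trm \<Rightarrow> bool" where
  "is_base B \<Longrightarrow> rule_Ar (App B (Plus M N)) (Plus (App B M) (App B N))"
| "is_base B \<Longrightarrow> rule_Ar (App B (Scale a M)) (Scale a (App B M))"
| "is_base B \<Longrightarrow> rule_Ar (App B Zero) Zero"

inductive rule_Asso :: "'a trm \<Rightarrow> 'a trm \<Rightarrow> bool" where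
  "rule_Asso (Plus M (Plus N L)) (Plus (Plus M N) L)"
| "rule_Asso (Plus (Plus M N) L) (Plus M (Plus N L))"

inductive rule_Com :: "'a trm \<Rightarrow> 'a trm \<Rightarrow> bool" where
  "rule_Com (Plus M N) (Plus N M)"

inductive rule_F :: "'a::{ring, monoid_mult} trm \<Rightarrow> 'a trm \<Rightarrow> bool" where
  "rule_F (Plus (Scale a M) (Scale b M)) (Scale (a + b) M)"
| "rule_F (Plus (Scale a M) M) (Scale (a + 1) M)"
| "rule_F (Plus M M) (Scale (1 + 1) M)"
| "rule_F (Scale a (Scale b M)) (Scale (a * b) M)"

inductive rule_S :: "'a::{ring, monoid_mult} trm \<Rightarrow> 'a trm \<Rightarrow> bool" where
  "rule_S (Scale a (Plus M N)) (Plus (Scale a M) (Scale a N))"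
| "rule_S (Scale 1 M) M"
| "rule_S (Scale 0 M) Zero"
| "rule_S (Scale a Zero) Zero"
| "rule_S (Plus Zero M) M"

definition rule_L :: "'a::{ring, monoid_mult} trm \<Rightarrow> 'a trm \<Rightarrow> bool" where
  "rule_L = sup rule_Asso (sup rule_Com (sup rule_F rule_S))"

text \<open>Closure under the context rules \<open>\<xi>\<close>, and under \<open>\<xi>\<close> and \<open>\<xi>\<^sub>l\<^sub>i\<^sub>n\<close>; there is no
  reduction under \<open>\<lambda>\<close>.\<close>

inductive ctx_xi :: "('a trm \<Rightarrow> 'a trm \<Rightarrow> bool) \<Rightarrow> 'a trm \<Rightarrow> 'a trm \<Rightarrow> bool"
  for R :: "'a trm \<Rightarrow> 'a trm \<Rightarrow> bool" where
  base: "R M M' \<Longrightarrow> ctx_xi R M M'"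
| appL: "ctx_xi R M M' \<Longrightarrow> ctx_xi R (App M N) (App M' N)"
| plusL: "ctx_xi R M M' \<Longrightarrow> ctx_xi R (Plus M N) (Plus M' N)"
| plusR: "ctx_xi R M M' \<Longrightarrow> ctx_xi R (Plus N M) (Plus N M')"
| scale: "ctx_xi R M M' \<Longrightarrow> ctx_xi R (Scale a M) (Scale a M')"

inductive ctx_xi_lin :: "('a trm \<Rightarrow> 'a trm \<Rightarrow> bool) \<Rightarrow> 'a trm \<Rightarrow> 'a trm \<Rightarrow> bool"
  for R :: "'a trm \<Rightarrow> 'a trm \<Rightarrow> bool" where
  base: "R M M' \<Longrightarrow> ctx_xi_lin R M M'"
| appL: "ctx_xi_lin R M M' \<Longrightarrow> ctx_xi_lin R (App M N) (App M' N)"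
| plusL: "ctx_xi_lin R M M' \<Longrightarrow> ctx_xi_lin R (Plus M N) (Plus M' N)"
| plusR: "ctx_xi_lin R M M' \<Longrightarrow> ctx_xi_lin R (Plus N M) (Plus N M')"
| scale: "ctx_xi_lin R M M' \<Longrightarrow> ctx_xi_lin R (Scale a M) (Scale a M')"
| appR: "is_value V \<Longrightarrow> ctx_xi_lin R M M' \<Longrightarrow> ctx_xi_lin R (App V M) (App V M')"

definition step_a :: "'a::{ring, monoid_mult} trm \<Rightarrow> 'a trm \<Rightarrow> bool" where
  "step_a = ctx_xi (sup rule_A rule_L)"

definition step_l :: "'a::{ring, monoid_mult} trm \<Rightarrow> 'a trm \<Rightarrow> bool" where
  "step_l = ctx_xi_lin (sup rule_Al (sup rule_Ar rule_L))"

definition step_beta_n :: "'a trm \<Rightarrow> 'a trm \<Rightarrow> bool" where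
  "step_beta_n = ctx_xi rule_beta_n"

definition step_beta_v :: "'a trm \<Rightarrow> 'a trm \<Rightarrow> bool" where
  "step_beta_v = ctx_xi_lin rule_beta_v"

definition red_lin :: "'a::{ring, monoid_mult} trm \<Rightarrow> 'a trm \<Rightarrow> bool" where
  "red_lin = sup step_l step_beta_v"

definition red_alg :: "'a::{ring, monoid_mult} trm \<Rightarrow> 'a trm \<Rightarrow> bool" where
  "red_alg = sup step_a step_beta_n"


section \<open>Fragments\<close>

definition restrict_rel :: "('b \<Rightarrow> 'b \<Rightarrow> bool) \<Rightarrow> 'b set \<Rightarrow> 'b \<Rightarrow> 'b \<Rightarrow> bool" where
  "restrict_rel R S x y \<longleftrightarrow> x \<in> S \<and> y \<in> S \<and> R x y"

definition fragment :: "('b \<Rightarrow> 'b \<Rightarrow> bool) \<Rightarrow> 'b set \<Rightarrow> bool" where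
  "fragment R S \<longleftrightarrow> (\<forall>M N. M \<in> S \<longrightarrow> R M N \<longrightarrow> N \<in> S)"

definition confluent_fragment :: "('b \<Rightarrow> 'b \<Rightarrow> bool) \<Rightarrow> 'b set \<Rightarrow> bool" where
  "confluent_fragment R S \<longleftrightarrow> fragment R S \<and> confluentp (restrict_rel R S)"

text \<open>Confluence of a fragment refers to the oriented reduction \<open>red_lin\<close> (resp. \<open>red_alg\<close>);
  only the algebraic steps are made symmetric below, and only between terms of \<open>S\<close>.\<close>

definition eq_step_l ::
    "'a::{ring, monoid_mult} trm set \<Rightarrow> 'a trm \<Rightarrow> 'a trm \<Rightarrow> bool" where
  "eq_step_l S M N \<longleftrightarrow> M \<in> S \<and> N \<in> S \<and> (step_l M N \<or> step_l N M)"

definition eq_step_a ::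
    "'a::{ring, monoid_mult} trm set \<Rightarrow> 'a trm \<Rightarrow> 'a trm \<Rightarrow> bool" where
  "eq_step_a S M N \<longleftrightarrow> M \<in> S \<and> N \<in> S \<and> (step_a M N \<or> step_a N M)"

definition eq_red_lin ::
    "'a::{ring, monoid_mult} trm set \<Rightarrow> 'a trm \<Rightarrow> 'a trm \<Rightarrow> bool" where
  "eq_red_lin S = sup (eq_step_l S) step_beta_v"

definition eq_red_alg ::
    "'a::{ring, monoid_mult} trm set \<Rightarrow> 'a trm \<Rightarrow> 'a trm \<Rightarrow> bool" where
  "eq_red_alg S = sup (eq_step_a S) step_beta_n"


section \<open>Translations\<close>

text \<open>A translated subterm is lifted once for each fresh binder it is placed under.  In
  \<open>tilde (App M N)\<close>, the indices below the three fresh binders \<open>f\<close>, \<open>g\<close>, \<open>h\<close> are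
  \<open>h = 0\<close>, \<open>g = 1\<close>, \<open>f = 2\<close>; in \<open>bar (App M N)\<close>, below \<open>f\<close> and \<open>g\<close>, they are
  \<open>g = 0\<close>, \<open>f = 1\<close>.\<close>

primrec tilde :: "'a trm \<Rightarrow> 'a trm" where
  "tilde (Var x) = Lam (App (Var 0) (lift (Var x) 0))"
| "tilde Zero = Zero"
| "tilde (Lam M) = Lam (App (Var 0) (lift (Lam (tilde M)) 0))"
| "tilde (App M N) =
    Lam (App (lift (tilde M) 0)
             (Lam (App (lift (lift (tilde N) 0) 0)
                       (Lam (App (App (Var 1) (Var 0)) (Var 2))))))"
| "tilde (Scale a M) = Lam (App (Scale a (lift (tilde M) 0)) (Var 0))"
| "tilde (Plus M N) = Lam (App (Plus (lift (tilde M) 0) (lift (tilde N) 0)) (Var 0))"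

primrec bar :: "'a trm \<Rightarrow> 'a trm" where
  "bar (Var x) = Var x"
| "bar Zero = Lam (App Zero (Var 0))"
| "bar (Lam M) = Lam (App (Var 0) (lift (Lam (bar M)) 0))"
| "bar (App M N) =
    Lam (App (lift (bar M) 0)
             (Lam (App (App (Var 0) (lift (lift (bar N) 0) 0)) (Var 1))))"
| "bar (Scale a M) = Lam (App (Scale a (lift (bar M) 0)) (Var 0))"
| "bar (Plus M N) = Lam (App (Plus (lift (bar M) 0) (lift (bar N) 0)) (Var 0))"

text \<open>\<open>Psi\<close> and \<open>Phi\<close> are meaningful only on values; they are left undefined on
  applications.\<close>

fun Psi :: "'a trm \<Rightarrow> 'a trm" where
  "Psi (Var x) = Var x"
| "Psi Zero = Zero"
| "Psi (Lam M) = Lam (tilde M)"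
| "Psi (Scale a V) = Scale a (Psi V)"
| "Psi (Plus V W) = Plus (Psi V) (Psi W)"

fun Phi :: "'a trm \<Rightarrow> 'a trm" where
  "Phi (Var x) = App (Var x) (Lam (Var 0))"
| "Phi Zero = Zero"
| "Phi (Lam M) = Lam (bar M)"
| "Phi (Scale a V) = Scale a (Phi V)"
| "Phi (Plus V W) = Plus (Phi V) (Phi W)"

end

theory Submission
  imports Defs
begin

text \<open>
  Algebraic steps may be read as conversions, so confluence of the fragment joins \<open>M\<close> and \<open>V\<close> by
  oriented reductions; as values only admit algebraic steps, the common reduct \<open>V'\<close> is a value
  that is algebraically equal to \<open>V\<close>.  It remains to simulate the oriented reduction
  from \<open>M\<close> to \<open>V'\<close>.  This is done by a colon translation in the sense of Plotkin, which maps
  \<open>M\<close> and a continuation \<open>K\<close> to a term reached from the image of \<open>M\<close> applied to \<open>K\<close>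
  by performing administrative reductions, and which is linear in \<open>M\<close>.
\<close>

section \<open>De Bruijn indices\<close>

lemma lift_lift: "i \<le> k \<Longrightarrow> lift (lift t i) (Suc k) = lift (lift t k) i"
  by (induction t arbitrary: i k) auto

lemma subst_lift [simp]: "subst (lift t k) s k = t"
  by (induction t arbitrary: k s) auto

lemma lift_subst: "i \<le> k \<Longrightarrow> lift (subst t s k) i = subst (lift t i) (lift s i) (Suc k)"
proof (induction t arbitrary: i k s)
  case (Var x)
  then show ?case by (cases x) auto
qed (auto simp: lift_lift)

text \<open>Contracting the outer \<open>Lam\<close> of a translated application leaves this
  substitution at its argument, which sits under two fresh binders.\<close>

lemma subst_lift_lift [simp]:
  "subst (lift (lift t 0) 0) (lift s 0) (Suc 0) = lift t 0"
  using lift_subst[of 0 0 "lift t 0" s] by simp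

section \<open>Translations under lifting and substitution\<close>

lemma tilde_lift: "tilde (lift t k) = lift (tilde t) k"
  by (induction t arbitrary: k) (auto simp: lift_lift)

lemma bar_lift: "bar (lift t k) = lift (bar t) k"
  by (induction t arbitrary: k) (auto simp: lift_lift)

lemma is_base_cases:
  assumes "is_base B"
  obtains x where "B = Var x" | M where "B = Lam M"
  using assms by (cases B) auto

lemma is_base_lift [simp]: "is_base B \<Longrightarrow> is_base (lift B k)"
  by (cases B) auto

lemma Psi_lift: "is_base B \<Longrightarrow> Psi (lift B k) = lift (Psi B) k"
  by (cases B) (auto simp: tilde_lift)

text \<open>Variables and abstractions share one shape, so substituting \<open>Psi B\<close> into
  the image of a variable gives the image of \<open>B\<close>. This is the variable case of
  \<open>tilde_subst\<close>.\<close>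

lemma tilde_base: "is_base B \<Longrightarrow> tilde B = Lam (App (Var 0) (lift (Psi B) 0))"
  by (cases B) auto

lemma tilde_subst: "is_base B \<Longrightarrow> tilde (subst t B k) = subst (tilde t) (Psi B) k"
  by (induction t arbitrary: k B) (auto simp: lift_subst lift_lift Psi_lift tilde_base)

text \<open>Call-by-name substitutes arbitrary terms; \<open>bar\<close> permits this because it
  leaves variables unchanged.\<close>

lemma bar_subst: "bar (subst t s k) = subst (bar t) (bar s) k"
  by (induction t arbitrary: k s) (auto simp: lift_subst lift_lift bar_lift)

text \<open>Lets \<open>rule_beta_v\<close> pass the image of an unevaluated argument.\<close>

lemma is_base_bar [simp]: "is_base (bar t)"
  by (cases t) auto


section \<open>Reductions and values\<close>

lemma is_value_simps [simp]:
  "is_value (Var x)" "is_value Zero" "is_value (Lam M)" "\<not> is_value (App M N)"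
  "is_value (Scale a M) \<longleftrightarrow> is_value M"
  "is_value (Plus M N) \<longleftrightarrow> is_value M \<and> is_value N"
  by (subst is_value.simps; auto)+

lemma is_value_base [simp]: "is_base B \<Longrightarrow> is_value B"
  by (rule is_value.intros)

text \<open>Turns a union of closures into a single closure, so that each simulation is one
  induction over contexts.\<close>

lemma ctx_xi_sup: "ctx_xi (sup R Q) = sup (ctx_xi R) (ctx_xi Q)"
proof (intro ext iffI)
  fix M N
  show "ctx_xi (sup R Q) M N \<Longrightarrow> sup (ctx_xi R) (ctx_xi Q) M N"
    by (induction rule: ctx_xi.induct) (auto intro: ctx_xi.intros)
  have "ctx_xi R M N \<Longrightarrow> ctx_xi (sup R Q) M N"
    by (induction rule: ctx_xi.induct) (auto intro: ctx_xi.intros)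
  moreover have "ctx_xi Q M N \<Longrightarrow> ctx_xi (sup R Q) M N"
    by (induction rule: ctx_xi.induct) (auto intro: ctx_xi.intros)
  ultimately show "sup (ctx_xi R) (ctx_xi Q) M N \<Longrightarrow> ctx_xi (sup R Q) M N"
    by auto
qed

lemma ctx_xi_lin_sup: "ctx_xi_lin (sup R Q) = sup (ctx_xi_lin R) (ctx_xi_lin Q)"
proof (intro ext iffI)
  fix M N
  show "ctx_xi_lin (sup R Q) M N \<Longrightarrow> sup (ctx_xi_lin R) (ctx_xi_lin Q) M N"
    by (induction rule: ctx_xi_lin.induct) (auto intro: ctx_xi_lin.intros)
  have "ctx_xi_lin R M N \<Longrightarrow> ctx_xi_lin (sup R Q) M N"
    by (induction rule: ctx_xi_lin.induct) (auto intro: ctx_xi_lin.intros)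
  moreover have "ctx_xi_lin Q M N \<Longrightarrow> ctx_xi_lin (sup R Q) M N"
    by (induction rule: ctx_xi_lin.induct) (auto intro: ctx_xi_lin.intros)
  ultimately show "sup (ctx_xi_lin R) (ctx_xi_lin Q) M N \<Longrightarrow> ctx_xi_lin (sup R Q) M N"
    by auto
qed

lemma red_lin_ctx:
  "red_lin = ctx_xi_lin (sup (sup rule_Al (sup rule_Ar rule_L)) rule_beta_v)"
  by (simp only: red_lin_def step_l_def step_beta_v_def ctx_xi_lin_sup)

lemma red_alg_ctx: "red_alg = ctx_xi (sup (sup rule_A rule_L) rule_beta_n)"
  by (simp only: red_alg_def step_a_def step_beta_n_def ctx_xi_sup)

lemma rule_L_cases:
  assumes "rule_L M N"
  obtains "rule_Asso M N" | "rule_Com M N" | "rule_F M N" | "rule_S M N"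
  using assms by (auto simp: rule_L_def)

lemma rule_L_is_value: "rule_L M N \<Longrightarrow> is_value M \<Longrightarrow> is_value N"
  by (erule rule_L_cases)
     (auto elim: rule_Asso.cases rule_Com.cases rule_F.cases rule_S.cases)

text \<open>Outside abstractions a value contains no application, so only the rules of
  \<open>rule_L\<close> apply, and these merely rearrange sums and scalars.\<close>

lemma red_lin_is_value:
  "red_lin M N \<Longrightarrow> is_value M \<Longrightarrow> step_l M N \<and> is_value N"
proof -
  have "ctx_xi_lin rule_beta_v M N \<Longrightarrow> \<not> is_value M"
    by (induction rule: ctx_xi_lin.induct) (auto elim: rule_beta_v.cases)
  moreover have "step_l M N \<Longrightarrow> is_value M \<Longrightarrow> is_value N"
    unfolding step_l_def
    by (induction rule: ctx_xi_lin.induct)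
       (auto dest: rule_L_is_value elim: rule_Al.cases rule_Ar.cases)
  ultimately show "red_lin M N \<Longrightarrow> is_value M \<Longrightarrow> step_l M N \<and> is_value N"
    by (auto simp: red_lin_def step_beta_v_def)
qed

lemma red_alg_is_value:
  "red_alg M N \<Longrightarrow> is_value M \<Longrightarrow> step_a M N \<and> is_value N"
proof -
  have "ctx_xi rule_beta_n M N \<Longrightarrow> \<not> is_value M"
    by (induction rule: ctx_xi.induct) (auto elim: rule_beta_n.cases)
  moreover have "step_a M N \<Longrightarrow> is_value M \<Longrightarrow> is_value N"
    unfolding step_a_def
    by (induction rule: ctx_xi.induct) (auto dest: rule_L_is_value elim: rule_A.cases)
  ultimately show "red_alg M N \<Longrightarrow> is_value M \<Longrightarrow> step_a M N \<and> is_value N"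
    by (auto simp: red_alg_def step_beta_n_def)
qed


section \<open>Linear maps on terms\<close>

definition linear_map :: "('a trm \<Rightarrow> 'a trm) \<Rightarrow> bool" where
  "linear_map \<phi> \<longleftrightarrow> \<phi> Zero = Zero \<and> (\<forall>a M. \<phi> (Scale a M) = Scale a (\<phi> M)) \<and>
     (\<forall>M N. \<phi> (Plus M N) = Plus (\<phi> M) (\<phi> N))"

text \<open>The schemes of \<open>rule_L\<close> are built from metavariables by sums, scalings and
  zero alone, and \<open>\<phi>\<close> commutes with all three.\<close>

lemma rule_L_linear_map:
  assumes "linear_map \<phi>" "rule_L M N"
  shows "rule_L (\<phi> M) (\<phi> N)"
  using assms(2)
proof (cases rule: rule_L_cases)
  case 1
  then have "rule_Asso (\<phi> M) (\<phi> N)"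
    using assms(1) by cases (auto simp: linear_map_def intro: rule_Asso.intros)
  then show ?thesis by (simp add: rule_L_def)
next
  case 2
  then have "rule_Com (\<phi> M) (\<phi> N)"
    using assms(1) by cases (auto simp: linear_map_def intro: rule_Com.intros)
  then show ?thesis by (simp add: rule_L_def)
next
  case 3
  then have "rule_F (\<phi> M) (\<phi> N)"
    using assms(1) by cases (auto simp: linear_map_def intro: rule_F.intros)
  then show ?thesis by (simp add: rule_L_def)
next
  case 4
  then have "rule_S (\<phi> M) (\<phi> N)"
    using assms(1) by cases (auto simp: linear_map_def intro: rule_S.intros)
  then show ?thesis by (simp add: rule_L_def)
qed

text \<open>On a value, the leaves that reach \<open>\<kappa>\<close> are its base terms.
  \<open>Psi\<close>, \<open>Phi\<close> and both colon translations at a fixed continuation have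
  this form on values.\<close>

primrec linear_ext :: "('a trm \<Rightarrow> 'a trm) \<Rightarrow> 'a trm \<Rightarrow> 'a trm" where
  "linear_ext \<kappa> (Var x) = \<kappa> (Var x)"
| "linear_ext \<kappa> Zero = Zero"
| "linear_ext \<kappa> (Lam M) = \<kappa> (Lam M)"
| "linear_ext \<kappa> (App M N) = \<kappa> (App M N)"
| "linear_ext \<kappa> (Scale a M) = Scale a (linear_ext \<kappa> M)"
| "linear_ext \<kappa> (Plus M N) = Plus (linear_ext \<kappa> M) (linear_ext \<kappa> N)"

lemma linear_map_linear_ext: "linear_map (linear_ext \<kappa>)"
  by (simp add: linear_map_def)

lemma linear_ext_base [simp]: "is_base B \<Longrightarrow> linear_ext \<kappa> B = \<kappa> B"
  by (cases B) auto

lemma linear_ext_eq: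
  assumes "linear_map \<phi>" "is_value V" "\<And>B. is_base B \<Longrightarrow> \<phi> B = \<kappa> B"
  shows "linear_ext \<kappa> V = \<phi> V"
  using assms(2,1,3) by (induction V rule: is_value.induct) (auto simp: linear_map_def)

text \<open>Collects the context rules common to both languages, so that the lemmas below serve
  \<open>red_alg\<close> and \<open>red_lin\<close> alike.\<close>

locale algebraic_congruence =
  fixes r :: "'a trm \<Rightarrow> 'a trm \<Rightarrow> bool"
  assumes appL: "r M M' \<Longrightarrow> r (App M N) (App M' N)"
    and plusL: "r M M' \<Longrightarrow> r (Plus M N) (Plus M' N)"
    and plusR: "r M M' \<Longrightarrow> r (Plus N M) (Plus N M')"
    and scale: "r M M' \<Longrightarrow> r (Scale a M) (Scale a M')"
begin

lemma rtranclp_scale: "r\<^sup>*\<^sup>* M M' \<Longrightarrow> r\<^sup>*\<^sup>* (Scale a M) (Scale a M')"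
  by (induction rule: rtranclp_induct) (blast intro: scale rtranclp.rtrancl_into_rtrancl)+

lemma rtranclp_plus:
  assumes "r\<^sup>*\<^sup>* M M'" "r\<^sup>*\<^sup>* N N'"
  shows "r\<^sup>*\<^sup>* (Plus M N) (Plus M' N')"
proof -
  have "r\<^sup>*\<^sup>* (Plus M N) (Plus M' N)"
    using assms(1)
    by (induction rule: rtranclp_induct) (blast intro: plusL rtranclp.rtrancl_into_rtrancl)+
  also have "r\<^sup>*\<^sup>* (Plus M' N) (Plus M' N')"
    using assms(2)
    by (induction rule: rtranclp_induct) (blast intro: plusR rtranclp.rtrancl_into_rtrancl)+
  finally show ?thesis .
qed

lemma rtranclp_linear_ext:
  assumes "is_value V" "\<And>B. is_base B \<Longrightarrow> r\<^sup>*\<^sup>* (\<kappa> B) (\<kappa>' B)"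
  shows "r\<^sup>*\<^sup>* (linear_ext \<kappa> V) (linear_ext \<kappa>' V)"
  using assms(1)
  by (induction V rule: is_value.induct) (auto intro: rtranclp_scale rtranclp_plus assms(2))

end

interpretation alg: algebraic_congruence red_alg
  by unfold_locales (auto simp: red_alg_ctx intro: ctx_xi.intros)

interpretation lin: algebraic_congruence red_lin
  by unfold_locales (auto simp: red_lin_ctx intro: ctx_xi_lin.intros)

lemma red_alg_beta: "red_alg (App (Lam M) N) (subst M N 0)"
  by (auto simp: red_alg_ctx intro: ctx_xi.base rule_beta_n.intros)

lemma red_alg_A: "rule_A M N \<Longrightarrow> red_alg M N"
  by (auto simp: red_alg_ctx intro: ctx_xi.base)

lemma red_alg_L: "rule_L M N \<Longrightarrow> red_alg M N"
  by (auto simp: red_alg_ctx intro: ctx_xi.base)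

lemma red_lin_beta: "is_base B \<Longrightarrow> red_lin (App (Lam M) B) (subst M B 0)"
  by (auto simp: red_lin_ctx intro: ctx_xi_lin.base rule_beta_v.intros)

lemma red_lin_Al: "rule_Al M N \<Longrightarrow> red_lin M N"
  by (auto simp: red_lin_ctx intro: ctx_xi_lin.base)

lemma red_lin_L: "rule_L M N \<Longrightarrow> red_lin M N"
  by (auto simp: red_lin_ctx intro: ctx_xi_lin.base)

text \<open>A redex in a value lies below sums and scalings only and is contracted by
  \<open>rule_L\<close>, which linear maps preserve. This handles reduction of a value in function
  position.\<close>

lemma red_alg_linear_ext:
  assumes "ctx_xi_lin R M N" "is_value M"
    "\<And>M N. R M N \<Longrightarrow> is_value M \<Longrightarrow> rule_L M N"
  shows "red_alg\<^sup>*\<^sup>* (linear_ext \<kappa> M) (linear_ext \<kappa> N)"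
  using assms(1,2)
proof (induction rule: ctx_xi_lin.induct)
  case (base M N)
  then show ?case
    by (blast intro: red_alg_L rule_L_linear_map[OF linear_map_linear_ext] assms(3))
qed (auto intro: alg.rtranclp_scale alg.rtranclp_plus)


section \<open>Simulating call-by-value by call-by-name\<close>

text \<open>The evaluation of \<open>App M N\<close> passes \<open>fun_cont N K\<close> to \<open>M\<close>, and then \<open>arg_cont B K\<close> to
  \<open>N\<close> for each base term \<open>B\<close> that occurs in the value of \<open>M\<close>.\<close>

definition fun_cont :: "'a trm \<Rightarrow> 'a trm \<Rightarrow> 'a trm" where
  "fun_cont N K = Lam (App (lift (tilde N) 0)
     (Lam (App (App (Var 1) (Var 0)) (lift (lift K 0) 0))))"

definition arg_cont :: "'a trm \<Rightarrow> 'a trm \<Rightarrow> 'a trm" where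
  "arg_cont B K = Lam (App (App (lift (Psi B) 0) (Var 0)) (lift K 0))"

text \<open>A value \<open>M\<close> allows reductions in its argument.  To follow them, \<open>colon_v\<close> distributes
  \<open>M\<close> over the application at once; the image of the argument would otherwise stay hidden
  under the binder of \<open>fun_cont\<close>.\<close>

primrec colon_v :: "'a trm \<Rightarrow> 'a trm \<Rightarrow> 'a trm" where
  "colon_v (Var x) = (\<lambda>K. App K (Psi (Var x)))"
| "colon_v Zero = (\<lambda>K. Zero)"
| "colon_v (Lam M) = (\<lambda>K. App K (Psi (Lam M)))"
| "colon_v (App M N) = (\<lambda>K. if is_value M
     then linear_ext (\<lambda>B. colon_v N (arg_cont B K)) M
     else colon_v M (fun_cont N K))"
| "colon_v (Scale a M) = (\<lambda>K. Scale a (colon_v M K))"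
| "colon_v (Plus M N) = (\<lambda>K. Plus (colon_v M K) (colon_v N K))"

lemma linear_map_colon_v: "linear_map (\<lambda>M. colon_v M K)"
  by (simp add: linear_map_def)

lemma colon_v_base [simp]: "is_base B \<Longrightarrow> colon_v B K = App K (Psi B)"
  by (cases B) auto

lemma colon_v_value: "is_value V \<Longrightarrow> colon_v V K = linear_ext (\<lambda>B. App K (Psi B)) V"
  using linear_ext_eq[OF linear_map_colon_v, of V K] by simp

lemma red_fun_cont:
  "red_alg (App (fun_cont N K) (Psi B)) (App (tilde N) (arg_cont B K))"
  unfolding fun_cont_def
  \<comment> \<open>\<open>back_subst\<close> leaves the equation between the formal beta reduct and
    the intended term to the simplifier.\<close>
  by (rule back_subst[of "red_alg _", OF red_alg_beta]) (simp add: arg_cont_def)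

lemma red_arg_cont:
  "red_alg (App (arg_cont B K) N) (App (App (Psi B) N) K)"
  unfolding arg_cont_def
  by (rule back_subst[of "red_alg _", OF red_alg_beta]) simp

text \<open>\<open>colon_v\<close> jumps ahead when \<open>M\<close> is a value; the image still
  waiting with \<open>fun_cont\<close> catches up by a beta step for each base term, followed by the
  reductions of \<open>tilde N\<close>. The premise is the induction hypothesis for \<open>N\<close>
  in \<open>tilde_colon_v\<close>.\<close>

lemma colon_v_fun_cont_aux:
  assumes "\<And>K. red_alg\<^sup>*\<^sup>* (App (tilde N) K) (colon_v N K)"
  shows "red_alg\<^sup>*\<^sup>* (colon_v M (fun_cont N K)) (colon_v (App M N) K)"
proof (cases "is_value M")
  case True
  have "red_alg\<^sup>*\<^sup>* (App (fun_cont N K) (Psi B)) (colon_v N (arg_cont B K))" for B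
    using red_fun_cont assms by (rule converse_rtranclp_into_rtranclp)
  then have "red_alg\<^sup>*\<^sup>* (linear_ext (\<lambda>B. App (fun_cont N K) (Psi B)) M)
      (linear_ext (\<lambda>B. colon_v N (arg_cont B K)) M)"
    by (intro alg.rtranclp_linear_ext True)
  then show ?thesis
    using True by (simp add: colon_v_value)
qed simp

lemma tilde_colon_v: "red_alg\<^sup>*\<^sup>* (App (tilde M) K) (colon_v M K)"
proof (induction M arbitrary: K)
  case (Var x)
  show ?case
    using red_alg_beta[of "App (Var 0) (lift (Var x) 0)" K] by auto
next
  case Zero
  show ?case by (auto intro: red_alg_A rule_A.intros)
next
  case (Lam M)
  show ?case
    using red_alg_beta[of "App (Var 0) (lift (Lam (tilde M)) 0)" K] by (auto simp del: lift.simps)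
next
  case (App M N)
  have "red_alg (App (tilde (App M N)) K) (App (tilde M) (fun_cont N K))"
    unfolding tilde.simps
    by (rule back_subst[of "red_alg _", OF red_alg_beta]) (simp add: fun_cont_def)
  also have "red_alg\<^sup>*\<^sup>* \<dots> (colon_v M (fun_cont N K))"
    by (rule App.IH)
  also have "red_alg\<^sup>*\<^sup>* \<dots> (colon_v (App M N) K)"
    by (intro colon_v_fun_cont_aux App.IH)
  finally show ?case .
next
  case (Scale a M)
  have "red_alg (App (tilde (Scale a M)) K) (App (Scale a (tilde M)) K)"
    unfolding tilde.simps
    by (rule back_subst[of "red_alg _", OF red_alg_beta]) simp
  also have "red_alg\<^sup>*\<^sup>* \<dots> (Scale a (App (tilde M) K))"
    by (intro r_into_rtranclp red_alg_A rule_A.intros)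
  also have "red_alg\<^sup>*\<^sup>* \<dots> (colon_v (Scale a M) K)"
    by (auto intro: alg.rtranclp_scale Scale.IH)
  finally show ?case .
next
  case (Plus M N)
  have "red_alg (App (tilde (Plus M N)) K) (App (Plus (tilde M) (tilde N)) K)"
    unfolding tilde.simps
    by (rule back_subst[of "red_alg _", OF red_alg_beta]) simp
  also have "red_alg\<^sup>*\<^sup>* \<dots> (Plus (App (tilde M) K) (App (tilde N) K))"
    by (intro r_into_rtranclp red_alg_A rule_A.intros)
  also have "red_alg\<^sup>*\<^sup>* \<dots> (colon_v (Plus M N) K)"
    by (auto intro: alg.rtranclp_plus Plus.IH)
  finally show ?case .
qed

lemmas colon_v_fun_cont = colon_v_fun_cont_aux[OF tilde_colon_v]

section \<open>Simulation of single call-by-value steps\<close>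

lemma colon_v_Al:
  assumes "rule_Al M N"
  shows "red_alg\<^sup>*\<^sup>* (colon_v M K) (colon_v N K)"
  using assms
proof cases
  case (1 V M1 M2)
  show ?thesis
  proof (cases "is_value (Plus M1 M2)")
    case False
    \<comment> \<open>The sum is not a value, but one summand may be; its image then has to catch up
      with the early distribution.\<close>
    have "red_alg\<^sup>*\<^sup>* (colon_v (Plus M1 M2) (fun_cont V K)) (colon_v N K)"
      unfolding 1 colon_v.simps(6) by (intro alg.rtranclp_plus colon_v_fun_cont)
    then show ?thesis using False unfolding 1 by (simp only: colon_v.simps(4) if_False)
  qed (use 1 in auto)
next
  case (2 V a M1)
  show ?thesis
  proof (cases "is_value (Scale a M1)")
    case False
    have "red_alg\<^sup>*\<^sup>* (colon_v (Scale a M1) (fun_cont V K)) (colon_v N K)"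
      unfolding 2 colon_v.simps(5) by (intro alg.rtranclp_scale colon_v_fun_cont)
    then show ?thesis using False unfolding 2 by (simp only: colon_v.simps(4) if_False)
  qed (use 2 in auto)
qed auto

text \<open>The function is a base term, hence a value, so \<open>colon_v\<close> passes
  \<open>arg_cont\<close> to the argument and is linear in it.\<close>

lemma colon_v_Ar: "rule_Ar M N \<Longrightarrow> colon_v M K = colon_v N K"
  by (erule rule_Ar.cases) auto

lemma colon_v_beta:
  assumes "rule_beta_v M N"
  shows "red_alg\<^sup>*\<^sup>* (colon_v M K) (colon_v N K)"
  using assms
proof cases
  case (1 B P)
  have "colon_v M K = App (arg_cont (Lam P) K) (Psi B)"
    using 1 by simp
  also have "red_alg\<^sup>*\<^sup>* \<dots> (App (App (Lam (tilde P)) (Psi B)) K)"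
    using red_arg_cont[of "Lam P" K "Psi B"] by auto
  \<comment> \<open>The argument is a base term, so \<open>tilde_subst\<close> identifies the
    contractum with \<open>tilde N\<close>.\<close>
  also have "red_alg\<^sup>*\<^sup>* \<dots> (App (tilde N) K)"
    using 1 by (auto simp: tilde_subst intro!: r_into_rtranclp alg.appL red_alg_beta)
  also have "red_alg\<^sup>*\<^sup>* \<dots> (colon_v N K)"
    by (rule tilde_colon_v)
  finally show ?thesis .
qed

text \<open>The continuation stays arbitrary because the induction hypothesis is used at
  \<open>fun_cont N K\<close> and at every \<open>arg_cont B K\<close>.\<close>

lemma red_lin_colon_v:
  "red_lin M N \<Longrightarrow> red_alg\<^sup>*\<^sup>* (colon_v M K) (colon_v N K)"
  unfolding red_lin_ctx
proof (induction arbitrary: K rule: ctx_xi_lin.induct)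
  case (base M N)
  then consider "rule_Al M N" | "rule_Ar M N" | "rule_L M N" | "rule_beta_v M N"
    by auto
  then show ?case
  proof cases
    case 2
    then show ?thesis by (simp add: colon_v_Ar[of M N])
  next
    case 3
    then show ?thesis
      by (intro r_into_rtranclp red_alg_L rule_L_linear_map[OF linear_map_colon_v])
  qed (auto intro: colon_v_Al colon_v_beta)
next
  case (appL M M' N)
  show ?case
  proof (cases "is_value M")
    case True
    have "is_value M'"
      using appL.hyps True red_lin_is_value unfolding red_lin_ctx by blast
    moreover have "red_alg\<^sup>*\<^sup>* (linear_ext \<kappa> M) (linear_ext \<kappa> M')" for \<kappa>
      using appL.hyps True
      by (rule red_alg_linear_ext) (auto elim: rule_Al.cases rule_Ar.cases rule_beta_v.cases)
    ultimately show ?thesis using True by simp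
  next
    case False
    then have "colon_v (App M N) K = colon_v M (fun_cont N K)"
      by simp
    also have "red_alg\<^sup>*\<^sup>* \<dots> (colon_v M' (fun_cont N K))"
      by (rule appL.IH)
    \<comment> \<open>\<open>M'\<close> may have become a value, in which case its image has to
      catch up.\<close>
    also have "red_alg\<^sup>*\<^sup>* \<dots> (colon_v (App M' N) K)"
      by (rule colon_v_fun_cont)
    finally show ?thesis .
  qed
next
  case (appR V M M')
  \<comment> \<open>As \<open>V\<close> is already distributed, the image of the argument is exposed
    once per base term of \<open>V\<close>, and the induction hypothesis applies to each
    copy.\<close>
  then show ?case by (simp add: alg.rtranclp_linear_ext)
qed (auto intro: alg.rtranclp_scale alg.rtranclp_plus)

lemma tilde_simulation:
  assumes "red_lin\<^sup>*\<^sup>* M V" "is_value V"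
  shows "red_alg\<^sup>*\<^sup>* (App (tilde M) (Lam (Var 0))) (Psi V)"
proof -
  have "red_alg\<^sup>*\<^sup>* (App (tilde M) (Lam (Var 0))) (colon_v M (Lam (Var 0)))"
    by (rule tilde_colon_v)
  also have "red_alg\<^sup>*\<^sup>* \<dots> (colon_v V (Lam (Var 0)))"
    using assms(1)
    by (induction rule: rtranclp_induct) (auto intro: red_lin_colon_v rtranclp_trans)
  also have "\<dots> = linear_ext (\<lambda>B. App (Lam (Var 0)) (Psi B)) V"
    using assms(2) by (rule colon_v_value)
  also have "red_alg\<^sup>*\<^sup>* \<dots> (linear_ext Psi V)"
    using assms(2) red_alg_beta[of "Var 0"] by (intro alg.rtranclp_linear_ext) auto
  also have "linear_ext Psi V = Psi V"
    using assms(2) by (intro linear_ext_eq) (auto simp: linear_map_def)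
  finally show ?thesis .
qed


section \<open>Simulating call-by-name by call-by-value\<close>

text \<open>Receives the value of the function and hands it the unevaluated argument.\<close>

definition name_cont :: "'a trm \<Rightarrow> 'a trm \<Rightarrow> 'a trm" where
  "name_cont N K = Lam (App (App (Var 0) (lift (bar N) 0)) (lift K 0))"

text \<open>Arguments are never reduced in call-by-name, so an application only extends the
  continuation. A variable stands for a suspended computation and therefore takes \<open>K\<close>
  as its argument.\<close>

primrec colon_n :: "'a trm \<Rightarrow> 'a trm \<Rightarrow> 'a trm" where
  "colon_n (Var x) = (\<lambda>K. App (Var x) K)"
| "colon_n Zero = (\<lambda>K. Zero)"
| "colon_n (Lam M) = (\<lambda>K. App K (Lam (bar M)))"
| "colon_n (App M N) = (\<lambda>K. colon_n M (name_cont N K))"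
| "colon_n (Scale a M) = (\<lambda>K. Scale a (colon_n M K))"
| "colon_n (Plus M N) = (\<lambda>K. Plus (colon_n M K) (colon_n N K))"

lemma linear_map_colon_n: "linear_map (\<lambda>M. colon_n M K)"
  by (simp add: linear_map_def)

lemma is_base_name_cont [simp]: "is_base (name_cont N K)"
  by (simp add: name_cont_def)

text \<open>A base continuation meets the side conditions of both \<open>rule_beta_v\<close> and
  \<open>rule_Al\<close>, and \<open>name_cont\<close> is again base.\<close>

lemma bar_colon_n: "is_base K \<Longrightarrow> red_lin\<^sup>*\<^sup>* (App (bar M) K) (colon_n M K)"
proof (induction M arbitrary: K)
  case (Var x)
  show ?case by simp
next
  case Zero
  have "red_lin (App (bar Zero) K) (App Zero K)"
    using red_lin_beta[OF Zero.prems, of "App Zero (Var 0)"] by simp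
  also have "red_lin\<^sup>*\<^sup>* \<dots> Zero"
    by (intro r_into_rtranclp red_lin_Al rule_Al.intros is_value_base Zero.prems)
  finally show ?case by simp
next
  case (Lam M)
  then show ?case
    using red_lin_beta[of K "App (Var 0) (lift (Lam (bar M)) 0)"]
    by (auto simp del: lift.simps)
next
  case (App M N)
  have "red_lin (App (bar (App M N)) K) (App (bar M) (name_cont N K))"
    unfolding bar.simps
    by (rule back_subst[of "red_lin _", OF red_lin_beta]) (simp_all add: name_cont_def App.prems)
  also have "red_lin\<^sup>*\<^sup>* \<dots> (colon_n (App M N) K)"
    by (auto intro: App.IH)
  finally show ?case .
next
  case (Scale a M)
  have "red_lin (App (bar (Scale a M)) K) (App (Scale a (bar M)) K)"
    unfolding bar.simps
    by (rule back_subst[of "red_lin _", OF red_lin_beta]) (simp_all add: Scale.prems)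
  also have "red_lin\<^sup>*\<^sup>* \<dots> (Scale a (App (bar M) K))"
    by (intro r_into_rtranclp red_lin_Al rule_Al.intros is_value_base Scale.prems)
  also have "red_lin\<^sup>*\<^sup>* \<dots> (colon_n (Scale a M) K)"
    by (auto intro: lin.rtranclp_scale Scale)
  finally show ?case .
next
  case (Plus M N)
  have "red_lin (App (bar (Plus M N)) K) (App (Plus (bar M) (bar N)) K)"
    unfolding bar.simps
    by (rule back_subst[of "red_lin _", OF red_lin_beta]) (simp_all add: Plus.prems)
  also have "red_lin\<^sup>*\<^sup>* \<dots> (Plus (App (bar M) K) (App (bar N) K))"
    by (intro r_into_rtranclp red_lin_Al rule_Al.intros is_value_base Plus.prems)
  also have "red_lin\<^sup>*\<^sup>* \<dots> (colon_n (Plus M N) K)"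
    by (auto intro: lin.rtranclp_plus Plus)
  finally show ?case .
qed

lemma colon_n_beta:
  assumes "rule_beta_n M N" "is_base K"
  shows "red_lin\<^sup>*\<^sup>* (colon_n M K) (colon_n N K)"
  using assms(1)
proof cases
  case (1 P Q)
  have "red_lin (App (name_cont Q K) (Lam (bar P))) (App (App (Lam (bar P)) (bar Q)) K)"
    unfolding name_cont_def
    by (rule back_subst[of "red_lin _", OF red_lin_beta]) simp_all
  \<comment> \<open>\<open>bar Q\<close> is base, so the call-by-name redex fires under
    call-by-value.\<close>
  also have "red_lin\<^sup>*\<^sup>* \<dots> (App (bar N) K)"
    unfolding 1 bar_subst by (intro r_into_rtranclp lin.appL red_lin_beta is_base_bar)
  also have "red_lin\<^sup>*\<^sup>* \<dots> (colon_n N K)"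
    using assms(2) by (rule bar_colon_n)
  finally show ?thesis by (simp add: 1)
qed

lemma red_alg_colon_n:
  "red_alg M N \<Longrightarrow> is_base K \<Longrightarrow> red_lin\<^sup>*\<^sup>* (colon_n M K) (colon_n N K)"
  unfolding red_alg_ctx
proof (induction arbitrary: K rule: ctx_xi.induct)
  case (base M N)
  then consider "rule_A M N" | "rule_L M N" | "rule_beta_n M N"
    by auto
  then show ?case
  proof cases
    case 2
    then show ?thesis
      by (intro r_into_rtranclp red_lin_L rule_L_linear_map[OF linear_map_colon_n])
  \<comment> \<open>The two sides of \<open>rule_A\<close> have the same image, since
    \<open>colon_n\<close> is linear in the function position.\<close>
  qed (use base.prems in \<open>auto intro: colon_n_beta elim: rule_A.cases\<close>)
qed (auto intro: lin.rtranclp_scale lin.rtranclp_plus)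

lemma bar_simulation:
  assumes "red_alg\<^sup>*\<^sup>* M V" "is_value V"
  shows "red_lin\<^sup>*\<^sup>* (App (bar M) (Lam (Var 0))) (Phi V)"
proof -
  have "red_lin\<^sup>*\<^sup>* (App (bar M) (Lam (Var 0))) (colon_n M (Lam (Var 0)))"
    by (rule bar_colon_n) simp
  also have "red_lin\<^sup>*\<^sup>* \<dots> (colon_n V (Lam (Var 0)))"
    using assms(1)
  proof (induction rule: rtranclp_induct)
    case (step P Q)
    have "red_lin\<^sup>*\<^sup>* (colon_n P (Lam (Var 0))) (colon_n Q (Lam (Var 0)))"
      using step.hyps(2) by (rule red_alg_colon_n) simp
    with step.IH show ?case by (rule rtranclp_trans)
  qed simp
  also have "\<dots> = linear_ext (\<lambda>B. colon_n B (Lam (Var 0))) V"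
    using linear_ext_eq[OF linear_map_colon_n assms(2)] by simp
  also have "red_lin\<^sup>*\<^sup>* \<dots> (linear_ext Phi V)"
  proof (rule lin.rtranclp_linear_ext[OF assms(2)])
    fix B :: "'a trm" assume "is_base B"
    \<comment> \<open>For a variable both sides coincide; for an abstraction the identity is
      contracted once.\<close>
    then show "red_lin\<^sup>*\<^sup>* (colon_n B (Lam (Var 0))) (Phi B)"
      using red_lin_beta[of "Lam _" "Var 0"] by (cases rule: is_base_cases) auto
  qed
  also have "linear_ext Phi V = Phi V"
    using assms(2) by (intro linear_ext_eq) (auto simp: linear_map_def)
  finally show ?thesis .
qed


section \<open>Confluent fragments\<close>

text \<open>The Church-Rosser argument: a forward step is closed by confluence, a backward step is
  prepended to the existing join.\<close>

lemma confluent_fragment_join: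
  assumes S: "confluent_fragment R S" and M: "M \<in> S"
    and conv: "E\<^sup>*\<^sup>* M N"
    and step: "\<And>P Q. P \<in> S \<Longrightarrow> E P Q \<Longrightarrow> R P Q \<or> (Q \<in> S \<and> R Q P)"
  shows "\<exists>L. (restrict_rel R S)\<^sup>*\<^sup>* M L \<and> (restrict_rel R S)\<^sup>*\<^sup>* N L"
proof -
  \<comment> \<open>Membership in \<open>S\<close> is carried along because confluence concerns the
    restricted relation.\<close>
  have "N \<in> S \<and> (\<exists>L. (restrict_rel R S)\<^sup>*\<^sup>* M L \<and> (restrict_rel R S)\<^sup>*\<^sup>* N L)"
    using conv
  proof (induction rule: rtranclp_induct)
    case base
    then show ?case using M by blast
  next
    case (step P Q)
    then obtain L where P: "P \<in> S" and L: "(restrict_rel R S)\<^sup>*\<^sup>* M L" "(restrict_rel R S)\<^sup>*\<^sup>* P L"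
      by blast
    from assms(4)[OF P step.hyps(2)] show ?case
    proof
      assume PQ: "R P Q"
      then have Q: "Q \<in> S"
        using S P by (auto simp: confluent_fragment_def fragment_def)
      have "(restrict_rel R S)\<^sup>*\<^sup>* P Q"
        using PQ P Q by (auto simp: restrict_rel_def)
      then obtain L' where "(restrict_rel R S)\<^sup>*\<^sup>* L L'" "(restrict_rel R S)\<^sup>*\<^sup>* Q L'"
        using S L(2) unfolding confluent_fragment_def by (meson confluentpD)
      then show ?thesis using L(1) Q by (meson rtranclp_trans)
    next
      assume QP: "Q \<in> S \<and> R Q P"
      then have "restrict_rel R S Q P"
        using P by (simp add: restrict_rel_def)
      then have "(restrict_rel R S)\<^sup>*\<^sup>* Q L"
        using L(2) by (rule converse_rtranclp_into_rtranclp)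
      with QP L(1) show ?thesis by blast
    qed
  qed
  then show ?thesis ..
qed

lemma restrict_rel_rtranclp: "(restrict_rel R S)\<^sup>*\<^sup>* M N \<Longrightarrow> R\<^sup>*\<^sup>* M N"
  by (erule rtranclp_mono[THEN predicate2D, rotated]) (auto simp: restrict_rel_def)

text \<open>Every oriented step from a value is algebraic, so inside \<open>S\<close> it is also a
  step of the restricted equality.\<close>

lemma restrict_red_lin_value:
  assumes "(restrict_rel red_lin S)\<^sup>*\<^sup>* V W" "is_value V"
  shows "is_value W \<and> (eq_step_l S)\<^sup>*\<^sup>* V W"
  using assms(1)
proof (induction rule: rtranclp_induct)
  case (step P Q)
  then have "is_value Q" "eq_step_l S P Q"
    using red_lin_is_value by (auto simp: restrict_rel_def eq_step_l_def)
  then show ?case using step.IH by auto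
qed (use assms(2) in auto)

lemma restrict_red_alg_value:
  assumes "(restrict_rel red_alg S)\<^sup>*\<^sup>* V W" "is_value V"
  shows "is_value W \<and> (eq_step_a S)\<^sup>*\<^sup>* V W"
  using assms(1)
proof (induction rule: rtranclp_induct)
  case (step P Q)
  then have "is_value Q" "eq_step_a S P Q"
    using red_alg_is_value by (auto simp: restrict_rel_def eq_step_a_def)
  then show ?case using step.IH by auto
qed (use assms(2) in auto)

theorem theorem11:
  shows "(\<forall>(S :: 'a::{ring, monoid_mult} trm set) M V.
            confluent_fragment red_lin S \<longrightarrow> M \<in> S \<longrightarrow> closed_trm M \<longrightarrow> is_value V \<longrightarrow>
            (eq_red_lin S)\<^sup>*\<^sup>* M V \<longrightarrow>
            (\<exists>V'. is_value V' \<and>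
                  red_alg\<^sup>*\<^sup>* (App (tilde M) (Lam (Var 0))) (Psi V') \<and>
                  (eq_step_l S)\<^sup>*\<^sup>* V V'))
       \<and> (\<forall>(S :: 'a trm set) M V.
            confluent_fragment red_alg S \<longrightarrow> M \<in> S \<longrightarrow> closed_trm M \<longrightarrow> is_value V \<longrightarrow>
            (eq_red_alg S)\<^sup>*\<^sup>* M V \<longrightarrow>
            (\<exists>V'. is_value V' \<and>
                  red_lin\<^sup>*\<^sup>* (App (bar M) (Lam (Var 0))) (Phi V') \<and>
                  (eq_step_a S)\<^sup>*\<^sup>* V V'))"
proof (intro conjI allI impI)
  fix S :: "'a trm set" and M V
  assume S: "confluent_fragment red_lin S" "M \<in> S" and V: "is_value V"
    and conv: "(eq_red_lin S)\<^sup>*\<^sup>* M V"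
  have "\<exists>L. (restrict_rel red_lin S)\<^sup>*\<^sup>* M L \<and> (restrict_rel red_lin S)\<^sup>*\<^sup>* V L"
    using S conv
    by (rule confluent_fragment_join) (auto simp: eq_red_lin_def eq_step_l_def red_lin_def)
  then obtain V' where V': "(restrict_rel red_lin S)\<^sup>*\<^sup>* M V'" "(restrict_rel red_lin S)\<^sup>*\<^sup>* V V'"
    by blast
  show "\<exists>V'. is_value V' \<and> red_alg\<^sup>*\<^sup>* (App (tilde M) (Lam (Var 0))) (Psi V') \<and>
      (eq_step_l S)\<^sup>*\<^sup>* V V'"
    using restrict_red_lin_value[OF V'(2) V] tilde_simulation[OF restrict_rel_rtranclp[OF V'(1)]]
    by blast
next
  fix S :: "'a trm set" and M V
  assume S: "confluent_fragment red_alg S" "M \<in> S" and V: "is_value V"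
    and conv: "(eq_red_alg S)\<^sup>*\<^sup>* M V"
  have "\<exists>L. (restrict_rel red_alg S)\<^sup>*\<^sup>* M L \<and> (restrict_rel red_alg S)\<^sup>*\<^sup>* V L"
    using S conv
    by (rule confluent_fragment_join) (auto simp: eq_red_alg_def eq_step_a_def red_alg_def)
  then obtain V' where V': "(restrict_rel red_alg S)\<^sup>*\<^sup>* M V'" "(restrict_rel red_alg S)\<^sup>*\<^sup>* V V'"
    by blast
  show "\<exists>V'. is_value V' \<and> red_lin\<^sup>*\<^sup>* (App (bar M) (Lam (Var 0))) (Phi V') \<and>
      (eq_step_a S)\<^sup>*\<^sup>* V V'"
    using restrict_red_alg_value[OF V'(2) V] bar_simulation[OF restrict_rel_rtranclp[OF V'(1)]]
    by blast
qed

end
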